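(* For every prime $p$ and all $k,n\in\mathbb{N}$, $$\dim_{\mathbb{Z}/p\mathbb{Z}}(\mathcal{H}^n)=\operatorname{rank}_{\mathbb{Z}/p\mathbb{Z}}(\mathcal{A}^*_{p^k,n})\leq \binom{p^k-1+n}{n}.$$
   Context: Let $p$ be prime, $k\in\mathbb{N}$, $R=\mathbb{Z}/p^k\mathbb{Z}$. For $x,y\in R^n$, $\langle x,y\rangle=x_1y_1+\dots+x_ny_n\in R$. Let $\mathbb{S}^{n-1}(R)$ be the set of vectors in $R^n$ having at least one coordinate invertible in $R$, and let the set of (nondegenerate) directions be $\mathbb{P}R^{n-1}=\mathbb{S}^{n-1}(R)/R^\times$, i.e. $b\sim\lambda b$ for $\lambda\in R^\times$. For $a\in R^n$ and a direction $b$, the (affine) hyperplane is $H_b(a)=\{x\in R^n:\langle x-a,b\rangle=0 \text{ in } R\}$ (independent of the representative of $b$). $\mathcal{H}^n$ is the linear span over $\mathbb{Z}/p\mathbb{Z}$ of the indicator functions $\mathbf{1}_{H_b(a)}:R^n\to\mathbb{Z}/p\mathbb{Z}$, $a\in R^n$, $b\in\mathbb{P}R^{n-1}$. The reduced point-affine hyperplane incidence matrix $\mathcal{A}^*_{p^k,n}$ has rows indexed by pairs $(a,b)\in R^n\times\mathbb{P}R^{n-1}$, columns indexed by $x\in R^n$, and entry $1$ if $x\in H_b(a)$ and $0$ otherwise; its rank is taken over $\mathbb{Z}/p\mathbb{Z}$. *)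

theory Defs
  imports "HOL-Analysis.Analysis" "Berlekamp_Zassenhaus.Finite_Field"
begin

text \<open>
  For a type \<open>'q\<close> with \<open>m\<close> elements, \<open>'q mod_ring\<close> is the ring of integers modulo \<open>m\<close>. Throughout,
  \<open>'q mod_ring\<close> plays the role of \<open>R\<close>, \<open>'q mod_ring ^ 'n\<close> that of \<open>R^n\<close>, and the prime field
  is \<open>'p mod_ring\<close>. A function from \<open>R^n\<close> to the prime field is an element of the coordinate
  space \<open>'p mod_ring ^ ('q mod_ring ^ 'n)\<close>, whose coordinates are indexed by the points of \<open>R^n\<close>.
\<close>

definition pairing :: "'a::comm_ring_1 ^ 'n \<Rightarrow> 'a ^ 'n \<Rightarrow> 'a" where
  "pairing x y = (\<Sum>i\<in>UNIV. x $ i * y $ i)"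

definition unit_sphere :: "('a::comm_ring_1 ^ 'n) set" where
  "unit_sphere = {b. \<exists>i. b $ i dvd 1}"

definition same_direction :: "'a::comm_ring_1 ^ 'n \<Rightarrow> 'a ^ 'n \<Rightarrow> bool" where
  "same_direction b c \<longleftrightarrow>
     b \<in> unit_sphere \<and> c \<in> unit_sphere \<and> (\<exists>u. u dvd 1 \<and> c = u *s b)"

lemma part_equivp_same_direction:
  "part_equivp (same_direction :: 'a::comm_ring_1 ^ 'n \<Rightarrow> 'a ^ 'n \<Rightarrow> bool)"
proof (rule part_equivpI)
  have "((\<chi> i. 1) :: 'a ^ 'n) \<in> unit_sphere"
    by (simp add: unit_sphere_def)
  moreover have "\<exists>u::'a. u dvd 1 \<and> b = u *s b" for b :: "'a ^ 'n"
    by (rule exI[of _ 1]) simp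
  ultimately show "\<exists>b. same_direction b (b :: 'a ^ 'n)"
    unfolding same_direction_def by blast
  show "symp (same_direction :: 'a ^ 'n \<Rightarrow> 'a ^ 'n \<Rightarrow> bool)"
  proof (rule sympI)
    fix b c :: "'a ^ 'n"
    assume bc: "same_direction b c"
    then obtain u where u: "u dvd 1" "c = u *s b"
      by (auto simp: same_direction_def)
    then obtain v where v: "1 = u * v" by (auto elim: dvdE)
    have "b = v *s c"
      using u(2) v by (simp add: vector_smult_assoc mult.commute)
    moreover have "v dvd 1" using v by (metis dvd_triv_right)
    ultimately show "same_direction c b"
      using bc by (auto simp: same_direction_def)
  qed
  show "transp (same_direction :: 'a ^ 'n \<Rightarrow> 'a ^ 'n \<Rightarrow> bool)"
  proof (rule transpI)
    fix b c d :: "'a ^ 'n"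
    assume bc: "same_direction b c" and cd: "same_direction c d"
    then obtain u v where u: "u dvd 1" "c = u *s b" and v: "v dvd 1" "d = v *s c"
      by (auto simp: same_direction_def)
    have "d = (v * u) *s b" using u v by (simp add: vector_smult_assoc)
    moreover have "v * u dvd 1" using u(1) v(1) mult_dvd_mono by fastforce
    ultimately show "same_direction b d"
      using bc cd by (auto simp: same_direction_def)
  qed
qed

text \<open>
  The quotient is partial: only vectors in \<^const>\<open>unit_sphere\<close> represent a direction.
\<close>

quotient_type (overloaded) ('a, 'n) direction = "'a::comm_ring_1 ^ 'n" / partial: same_direction
  by (rule part_equivp_same_direction)

instance direction :: ("{comm_ring_1, finite}", finite) finite
proof
  have "UNIV \<subseteq> range (abs_direction :: 'a ^ 'b \<Rightarrow> ('a, 'b) direction)"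
    by (metis Quotient_abs_rep Quotient_direction rangeI subsetI)
  then show "finite (UNIV :: ('a, 'b) direction set)"
    by (rule finite_subset) simp
qed

lift_definition hyperplane ::
    "('a::comm_ring_1, 'n::finite) direction \<Rightarrow> 'a ^ 'n \<Rightarrow> ('a ^ 'n) set"
  is "\<lambda>b a. {x. pairing (x - a) b = 0}"
proof -
  fix b c :: "'a ^ 'n"
  assume "same_direction b c"
  then obtain u where u: "u dvd 1" "c = u *s b"
    by (auto simp: same_direction_def)
  then obtain v where v: "1 = u * v" by (auto elim: dvdE)
  have eq: "pairing y c = u * pairing y b" for y
    by (simp add: pairing_def u(2) sum_distrib_left algebra_simps)
  have "pairing y b = 0" if "u * pairing y b = 0" for y
  proof -
    have "pairing y b = v * (u * pairing y b)"
      using v by (simp add: mult.assoc[symmetric] mult.commute)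
    then show ?thesis using that by simp
  qed
  then have "pairing y c = 0 \<longleftrightarrow> pairing y b = 0" for y
    by (auto simp: eq)
  then show "(\<lambda>a. {x. pairing (x - a) b = 0}) = (\<lambda>a. {x. pairing (x - a) c = 0})"
    by simp
qed

definition indicator_fun ::
    "('q::nontriv mod_ring ^ 'n) set \<Rightarrow> 'p::prime_card mod_ring ^ ('q mod_ring ^ 'n)" where
  "indicator_fun X = (\<chi> x. if x \<in> X then 1 else 0)"

definition hyperplane_space ::
    "('p::prime_card mod_ring ^ ('q::nontriv mod_ring ^ 'n)) set" where
  "hyperplane_space = vec.span {indicator_fun (hyperplane b a) | a b. True}"

definition incidence_matrix ::
    "'p::prime_card mod_ring ^ ('q::nontriv mod_ring ^ 'n)
       ^ (('q mod_ring ^ 'n) \<times> ('q mod_ring, 'n) direction)" where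
  "incidence_matrix = (\<chi> ab x. if x \<in> hyperplane (snd ab) (fst ab) then 1 else 0)"

end

theory Submission
  imports Defs
begin

text \<open>
  Let \<open>q = p^k\<close>. In characteristic \<open>p\<close> we have \<open>(1 + T)^q = 1 + T^q\<close>, so the coefficient of
  \<open>T^(q-1)\<close> in \<open>(1 + T)^N\<close> is \<open>1\<close> if \<open>q\<close> divides \<open>N + 1\<close> and \<open>0\<close> otherwise. Taking
  \<open>N = c + b_1 x_1 + \<dots> + b_n x_n\<close> with nonnegative integer representatives and a suitable \<open>c\<close>,
  this coefficient is the indicator function of a hyperplane. Writing \<open>(1 + T)^b = 1 + T g_b\<close> and
  expanding each \<open>(1 + T g_b)^x\<close> by the binomial theorem, only the products
  \<open>binom(x_1, j_1) \<dots> binom(x_n, j_n)\<close> with \<open>j_1 + \<dots> + j_n \<le> q - 1\<close> contribute, and there are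
  \<open>binom(q - 1 + n, n)\<close> of these.
\<close>

hide_const (open) up_ring.coeff up_ring.monom

text \<open>Powers of an element congruent to 1 modulo \<open>u\<close> stay so. This is used with
  \<open>u\<close> = T^q, to discard terms of degree at least q, and with \<open>u\<close> = T, to
  produce the factors g_b.\<close>

lemma one_plus_mult_power:
  fixes u g :: "'a::comm_semiring_1"
  shows "\<exists>h. (1 + u * g) ^ m = 1 + u * h"
proof (induction m)
  case 0
  show ?case by (rule exI[of _ 0]) simp
next
  case (Suc m)
  then obtain h where "(1 + u * g) ^ m = 1 + u * h" by blast
  then have "(1 + u * g) ^ Suc m = 1 + u * (g + h + u * g * h)"
    by (simp add: algebra_simps)
  then show ?case by blast
qed

lemma coeff_one_plus_X_power:
  "coeff ([:1, 1:] ^ N :: 'a::comm_ring_1 poly) m = of_nat (N choose m)"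
proof -
  have "[:1, 1:] ^ N = ([:0, 1:] + 1 :: 'a poly) ^ N"
    by (simp add: one_pCons)
  also have "\<dots> = (\<Sum>j\<le>N. monom (of_nat (N choose j)) j)"
    by (simp add: binomial_ring of_nat_poly monom_altdef)
  finally show ?thesis
    by (auto simp: coeff_sum binomial_eq_0 not_le)
qed

text \<open>Split off (1 + T)^(q * (N div q)), which is 1 modulo T^q and so does not affect the
  coefficient at q - 1. What remains is binom(N mod q, q - 1), nonzero only for the largest possible
  remainder.\<close>

lemma coeff_one_plus_X_power_prime_power:
  fixes q N :: nat
  assumes "prime CHAR('a::comm_ring_1)" and q: "q = CHAR('a) ^ k"
  shows "coeff ([:1, 1:] ^ N :: 'a poly) (q - 1) = (if q dvd Suc N then 1 else 0)"
proof -
  have "q > 0" using assms by (simp add: prime_gt_0_nat)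
  have "[:1, 1:] ^ q = ([:1:] + [:0, 1:] :: 'a poly) ^ q"
    by simp
  also have "\<dots> = [:1:] ^ q + [:0, 1:] ^ q"
    unfolding q by (rule freshmans_dream') (use assms in simp_all)
  \<comment> \<open>The factor 1 gives the shape expected by
    \<open>one_plus_mult_power\<close>.\<close>
  also have "\<dots> = 1 + monom 1 q * 1"
    by (simp add: monom_altdef flip: one_pCons)
  finally have "([:1, 1:] ^ q :: 'a poly) ^ (N div q) = (1 + monom 1 q * 1) ^ (N div q)"
    by simp
  moreover obtain h where "(1 + monom 1 q * 1 :: 'a poly) ^ (N div q) = 1 + monom 1 q * h"
    using one_plus_mult_power by blast
  ultimately have h: "([:1, 1:] ^ q :: 'a poly) ^ (N div q) = 1 + monom 1 q * h"
    by simp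
  have "[:1, 1:] ^ N = ([:1, 1:] ^ q :: 'a poly) ^ (N div q) * [:1, 1:] ^ (N mod q)"
    by (simp flip: power_mult power_add)
  also have "\<dots> = [:1, 1:] ^ (N mod q) + monom 1 q * (h * [:1, 1:] ^ (N mod q))"
    unfolding h by (simp add: algebra_simps)
  finally have "coeff ([:1, 1:] ^ N :: 'a poly) (q - 1) = of_nat (N mod q choose (q - 1))"
    using \<open>q > 0\<close> by (simp add: coeff_monom_mult coeff_one_plus_X_power del: power_Suc)
  moreover have "N mod q = q - 1 \<longleftrightarrow> q dvd Suc N"
    using \<open>q > 0\<close> mod_Suc[of N q] by (auto simp: dvd_eq_mod_eq_0)
  moreover have "N mod q < q - 1" if "N mod q \<noteq> q - 1"
    using mod_less_divisor[OF \<open>q > 0\<close>, of N] that by linarith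
  ultimately show ?thesis
    by (auto simp: binomial_eq_0)
qed

text \<open>The quantifier order matters: \<alpha> is fixed before \<open>x\<close>, so the
  coefficient, as a function of \<open>x\<close>, is a linear combination of fixed functions. The
  uniform bound \<open>M\<close> keeps the index set finite and independent of
  \<open>x\<close>.\<close>

lemma coeff_one_plus_X_power_sum:
  fixes b :: "'n::finite \<Rightarrow> nat" and c m M :: nat
  shows "\<exists>\<alpha>. \<forall>x. (\<forall>i. x i \<le> M) \<longrightarrow>
    coeff ([:1, 1:] ^ (c + (\<Sum>i\<in>UNIV. b i * x i)) :: 'a::comm_ring_1 poly) m =
    (\<Sum>j | sum j UNIV \<le> m \<and> (\<forall>i. j i \<le> M). \<alpha> j * (\<Prod>i\<in>UNIV. of_nat (x i choose j i)))"
proof -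
  have "\<exists>h. ([:1, 1:] :: 'a poly) ^ b i = 1 + monom 1 1 * h" for i
    using one_plus_mult_power[of "monom 1 1" "1 :: 'a poly" "b i"]
    by (simp add: monom_altdef one_pCons)
  then obtain g where g: "([:1, 1:] :: 'a poly) ^ b i = 1 + monom 1 1 * g i" for i
    by metis
  \<comment> \<open>\<open>h j\<close> collects the factors free of \<open>x\<close>; its
    coefficient at m - sum j becomes \<alpha> j.\<close>
  define h where "h j = [:1, 1:] ^ c * (\<Prod>i\<in>UNIV. g i ^ j i)" for j
  define J where "J = {j :: 'n \<Rightarrow> nat. \<forall>i. j i \<le> M}"
  have J: "PiE UNIV (\<lambda>i. {..M}) = J"
    by (auto simp: J_def PiE_def Pi_def)
  have "finite J"
    unfolding J[symmetric] by (rule finite_PiE) auto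
  have "coeff ([:1, 1:] ^ (c + (\<Sum>i\<in>UNIV. b i * x i))) m =
    (\<Sum>j | sum j UNIV \<le> m \<and> (\<forall>i. j i \<le> M).
      coeff (h j) (m - sum j UNIV) * (\<Prod>i\<in>UNIV. of_nat (x i choose j i)))"
    if x: "\<forall>i. x i \<le> M" for x
  proof -
    have bin: "([:1, 1:] :: 'a poly) ^ (b i * x i) =
      (\<Sum>j\<le>M. monom (of_nat (x i choose j)) j * g i ^ j)" for i
    proof -
      have "([:1, 1:] :: 'a poly) ^ (b i * x i) = (monom 1 1 * g i + 1) ^ x i"
        by (simp add: power_mult g add.commute)
      also have "\<dots> = (\<Sum>j\<le>x i. monom (of_nat (x i choose j)) j * g i ^ j)"
        unfolding binomial_ring
        by (simp add: of_nat_poly power_mult_distrib monom_power smult_monom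
              flip: mult_smult_left)
      \<comment> \<open>The added terms vanish because \<open>j\<close> exceeds
        \<open>x i\<close>.\<close>
      also have "\<dots> = (\<Sum>j\<le>M. monom (of_nat (x i choose j)) j * g i ^ j)"
        using x by (intro sum.mono_neutral_left) (auto simp: binomial_eq_0)
      finally show ?thesis .
    qed
    have prod_monom: "(\<Prod>i\<in>A. monom (a i) (j i)) = monom (prod a A :: 'a) (sum j A)"
      if "finite A" for A :: "'n set" and a j
      using that by induction (simp_all add: mult_monom)
    have "[:1, 1:] ^ (c + (\<Sum>i\<in>UNIV. b i * x i)) =
      [:1, 1:] ^ c * (\<Prod>i\<in>UNIV. \<Sum>j\<le>M. monom (of_nat (x i choose j)) j * g i ^ j)"
      by (simp add: power_add power_sum bin)
    also have "\<dots> = (\<Sum>j\<in>J. monom (\<Prod>i\<in>UNIV. of_nat (x i choose j i)) (sum j UNIV) * h j)"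
      by (subst prod_sum_PiE)
        (simp_all add: J sum_distrib_left prod.distrib prod_monom h_def mult_ac)
    finally have "coeff ([:1, 1:] ^ (c + (\<Sum>i\<in>UNIV. b i * x i))) m =
      (\<Sum>j\<in>J. if sum j UNIV \<le> m
        then coeff (h j) (m - sum j UNIV) * (\<Prod>i\<in>UNIV. of_nat (x i choose j i)) else 0)"
      by (auto simp: coeff_sum coeff_monom_mult mult.commute[of "coeff _ _"] intro!: sum.cong)
    also have "\<dots> = (\<Sum>j\<in>{j\<in>J. sum j UNIV \<le> m}.
        coeff (h j) (m - sum j UNIV) * (\<Prod>i\<in>UNIV. of_nat (x i choose j i)))"
      using \<open>finite J\<close> by (simp add: sum.inter_filter)
    also have "{j\<in>J. sum j UNIV \<le> m} = {j. sum j UNIV \<le> m \<and> (\<forall>i. j i \<le> M)}"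
      by (auto simp: J_def)
    finally show ?thesis .
  qed
  then show ?thesis
    by (intro exI[of _ "\<lambda>j. coeff (h j) (m - sum j UNIV)"]) simp
qed

text \<open>Stars and bars: prepending the slack N - sum j turns the inequality into an equality on
  lists with one more entry.\<close>

lemma
  fixes N :: nat
  shows finite_functions_sum_le: "finite {j :: 'n::finite \<Rightarrow> nat. sum j UNIV \<le> N}"
    and card_functions_sum_le:
      "card {j :: 'n \<Rightarrow> nat. sum j UNIV \<le> N} \<le> (N + CARD('n)) choose CARD('n)"
proof -
  let ?F = "{j :: 'n \<Rightarrow> nat. sum j UNIV \<le> N}"
  let ?L = "{l :: nat list. length l = Suc CARD('n) \<and> sum_list l = N}"
  obtain xs :: "'n list" where xs: "set xs = UNIV" "distinct xs"
    using finite_distinct_list[OF finite_class.finite_UNIV] by blast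
  have len: "length xs = CARD('n)"
    using distinct_card[OF xs(2)] xs(1) by simp
  have sum: "sum_list (map j xs) = sum j UNIV" for j :: "'n \<Rightarrow> nat"
    using sum_list_distinct_conv_sum_set[OF xs(2)] xs(1) by simp
  have card_L: "card ?L = (N + CARD('n)) choose CARD('n)"
    by (subst card_length_sum_list) (simp add: binomial_symmetric[of N])
  \<comment> \<open>Infinite sets have cardinality 0, so the positive count gives
    finiteness.\<close>
  then have "finite ?L"
    by (intro card_ge_0_finite) simp
  have inj: "inj_on (\<lambda>j. (N - sum j UNIV) # map j xs) ?F"
    using xs(1) by (auto simp: inj_on_def fun_eq_iff)
  have sub: "(\<lambda>j. (N - sum j UNIV) # map j xs) ` ?F \<subseteq> ?L"
    by (auto simp: len sum)
  show "finite ?F"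
    using inj_on_finite[OF inj sub \<open>finite ?L\<close>] .
  show "card ?F \<le> (N + CARD('n)) choose CARD('n)"
    using card_inj_on_le[OF inj sub \<open>finite ?L\<close>] card_L by simp
qed

lemma of_nat_to_int_mod_ring: "of_nat (nat (to_int_mod_ring x)) = (x :: 'q::nontriv mod_ring)"
  and nat_to_int_mod_ring_less: "nat (to_int_mod_ring x) < CARD('q)"
proof -
  have "to_int_mod_ring x \<in> {0..<int CARD('q)}"
    using range_to_int_mod_ring[where 'a = 'q] by blast
  then show "of_nat (nat (to_int_mod_ring x)) = x" "nat (to_int_mod_ring x) < CARD('q)"
    by (auto simp: of_nat_of_int_mod_ring)
qed

text \<open>Division by j! can fail in characteristic p, so the binomials are formed from
  representatives in {0..<q} before reduction.\<close>

definition binomial_fun ::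
    "('n \<Rightarrow> nat) \<Rightarrow> 'p::prime_card mod_ring ^ ('q::nontriv mod_ring ^ 'n::finite)" where
  "binomial_fun j = (\<chi> x. \<Prod>i\<in>UNIV. of_nat (nat (to_int_mod_ring (x $ i)) choose j i))"

lemma indicator_hyperplane_in_span:
  fixes b :: "('q::nontriv mod_ring, 'n::finite) direction"
  assumes card: "CARD('q) = CARD('p::prime_card) ^ k"
  shows "(indicator_fun (hyperplane b a) :: 'p mod_ring ^ ('q mod_ring ^ 'n)) \<in>
    vec.span (binomial_fun ` {j. sum j UNIV \<le> CARD('q) - 1})"
proof -
  define q where "q = CARD('q)"
  define r where "r y = nat (to_int_mod_ring (y :: 'q mod_ring))" for y
  define \<beta> where "\<beta> = rep_direction b"
  \<comment> \<open>The summand q - 1 stands for -1 modulo q without leaving the naturals, so that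
    the successor of the exponent represents \<langle>x - a, \<beta>\<rangle> in R.\<close>
  define c where "c = r (- pairing a \<beta>) + (q - 1)"
  have q: "q > 0" by (simp add: q_def)
  have char: "prime CHAR('p mod_ring)" "q = CHAR('p mod_ring) ^ k"
    using card by (simp_all add: prime_card q_def)
  have r: "of_nat (r y) = y" "r y \<le> q - 1" for y
    using of_nat_to_int_mod_ring[of y] nat_to_int_mod_ring_less[of y] by (simp_all add: r_def q_def)
  have dvd: "q dvd Suc (c + (\<Sum>i\<in>UNIV. r (\<beta> $ i) * r (x $ i))) \<longleftrightarrow> x \<in> hyperplane b a" for x
  proof -
    have "q dvd Suc (c + (\<Sum>i\<in>UNIV. r (\<beta> $ i) * r (x $ i))) \<longleftrightarrow>
      q dvd q + (r (- pairing a \<beta>) + (\<Sum>i\<in>UNIV. r (\<beta> $ i) * r (x $ i)))"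
      using q by (simp add: c_def add_ac)
    also have "\<dots> \<longleftrightarrow> q dvd r (- pairing a \<beta>) + (\<Sum>i\<in>UNIV. r (\<beta> $ i) * r (x $ i))"
      by simp
    also have "\<dots> \<longleftrightarrow>
      of_nat (r (- pairing a \<beta>) + (\<Sum>i\<in>UNIV. r (\<beta> $ i) * r (x $ i))) = (0 :: 'q mod_ring)"
      by (simp only: of_nat_eq_0_iff_char_dvd semiring_char_mod_ring q_def)
    also have "\<dots> \<longleftrightarrow> pairing (x - a) \<beta> = 0"
      by (simp add: r pairing_def algebra_simps sum_subtractf)
    finally show ?thesis
      by (simp add: hyperplane.rep_eq \<beta>_def)
  qed
  obtain \<alpha> :: "('n \<Rightarrow> nat) \<Rightarrow> 'p mod_ring" where \<alpha>: "\<forall>x. (\<forall>i. x i \<le> q - 1) \<longrightarrow>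
    coeff ([:1, 1:] ^ (c + (\<Sum>i\<in>UNIV. r (\<beta> $ i) * x i))) (q - 1) =
    (\<Sum>j | sum j UNIV \<le> q - 1 \<and> (\<forall>i. j i \<le> q - 1). \<alpha> j * (\<Prod>i\<in>UNIV. of_nat (x i choose j i)))"
    using coeff_one_plus_X_power_sum[of "q - 1" c "\<lambda>i. r (\<beta> $ i)" "q - 1"] by (rule exE)
  have "(indicator_fun (hyperplane b a) :: 'p mod_ring ^ ('q mod_ring ^ 'n)) $ x =
    (\<Sum>j | sum j UNIV \<le> q - 1 \<and> (\<forall>i. j i \<le> q - 1). \<alpha> j *s binomial_fun j) $ x" for x
    using \<alpha>[THEN spec, of "\<lambda>i. r (x $ i)"] r(2)
    unfolding coeff_one_plus_X_power_prime_power[OF char] dvd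
    by (simp add: indicator_fun_def binomial_fun_def flip: r_def)
  then have "(indicator_fun (hyperplane b a) :: 'p mod_ring ^ ('q mod_ring ^ 'n)) =
    (\<Sum>j | sum j UNIV \<le> q - 1 \<and> (\<forall>i. j i \<le> q - 1). \<alpha> j *s binomial_fun j)"
    by (simp add: vec_eq_iff)
  \<comment> \<open>The coordinatewise bound only shrinks the index set, so every term belongs to
    the larger family.\<close>
  also have "\<dots> \<in> vec.span (binomial_fun ` {j. sum j UNIV \<le> q - 1})"
    by (intro vec.span_sum vec.span_scale vec.span_base) auto
  finally show ?thesis
    by (simp add: q_def)
qed

lemma row_incidence_matrix:
  "row ab incidence_matrix = indicator_fun (hyperplane (snd ab) (fst ab))"
  by (simp add: row_def incidence_matrix_def indicator_fun_def)

lemma rows_incidence_matrix: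
  "rows incidence_matrix = {indicator_fun (hyperplane b a) | a b. True}"
  by (simp add: rows_def row_incidence_matrix)

theorem theorem1p3:
  fixes p k n :: nat
  assumes "prime p"
    and "CARD('p::prime_card) = p"
    and "CARD('q::nontriv) = p ^ k"
    and "CARD('n::finite) = n"
  shows "vec.dim (hyperplane_space :: ('p mod_ring ^ ('q mod_ring ^ 'n)) set) =
           rank (incidence_matrix ::
             'p mod_ring ^ ('q mod_ring ^ 'n) ^ (('q mod_ring ^ 'n) \<times> ('q mod_ring, 'n) direction))
       \<and> rank (incidence_matrix ::
             'p mod_ring ^ ('q mod_ring ^ 'n) ^ (('q mod_ring ^ 'n) \<times> ('q mod_ring, 'n) direction))
         \<le> (p ^ k - 1 + n) choose n"
proof
  let ?A = "incidence_matrix ::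
    'p mod_ring ^ ('q mod_ring ^ 'n) ^ (('q mod_ring ^ 'n) \<times> ('q mod_ring, 'n) direction)"
  let ?J = "{j :: 'n \<Rightarrow> nat. sum j UNIV \<le> CARD('q) - 1}"
  show "vec.dim (hyperplane_space :: ('p mod_ring ^ ('q mod_ring ^ 'n)) set) = rank ?A"
    \<comment> \<open>Rank is row rank, the rows are exactly the generators, and passing to the span
      preserves dimension.\<close>
    by (simp add: hyperplane_space_def row_rank_def_gen rows_incidence_matrix)
  have "rows ?A \<subseteq> vec.span (binomial_fun ` ?J)"
    unfolding rows_incidence_matrix using indicator_hyperplane_in_span assms by blast
  then have "rank ?A \<le> card (binomial_fun ` ?J :: ('p mod_ring ^ ('q mod_ring ^ 'n)) set)"
    unfolding row_rank_def_gen
    by (rule vec.dim_le_card) (simp add: finite_functions_sum_le)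
  also have "\<dots> \<le> card ?J"
    by (rule card_image_le) (rule finite_functions_sum_le)
  also have "\<dots> \<le> (CARD('q) - 1 + CARD('n)) choose CARD('n)"
    by (rule card_functions_sum_le)
  finally show "rank ?A \<le> (p ^ k - 1 + n) choose n"
    using assms by simp
qed

end
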